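(* Let $r>1$ be a fixed integer and, for each integer $s\ge 2$, let $\lambda_{r,s}$ be the relative loss in expected value of the disadvantage experiment with $r$ rolls of a fair $s$-sided die. Then $$\lim_{s\to\infty}\lambda_{r,s}=\frac{r-1}{r+1}.$$
   Context: A fair $s$-sided die takes each value in $\{1,\dots,s\}$ with equal probability. The base experiment is rolling the die once; $X$ denotes its outcome, so $E[X]=\frac{s+1}{2}$. A disadvantage experiment consists of rolling the die $r$ times (independently, so that all $s^r$ sequences in $\{1,\dots,s\}^r$ are equally likely) and taking the smallest number rolled as the outcome; $L_{r,s}$ is the random variable giving this outcome, i.e. $L_{r,s}=\min(X_1,\dots,X_r)$ with $X_1,\dots,X_r$ independent and uniform on $\{1,\dots,s\}$. The relative loss in expected value of the disadvantage experiment is $$\lambda_{r,s}=\frac{E[X]-E[L_{r,s}]}{E[X]}.$$ *)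

theory Defs
  imports "HOL-Probability.Probability" "HOL-Probability.Product_PMF"
begin

definition die :: "nat \<Rightarrow> nat pmf" where
  "die s = pmf_of_set {1..s}"

text \<open>Only the restriction of a sample to the index set \<open>{1..r}\<close> is meaningful:
  \<^const>\<open>Pi_pmf\<close> gives every other coordinate the dummy value 0.\<close>

definition rolls :: "nat \<Rightarrow> nat \<Rightarrow> (nat \<Rightarrow> nat) pmf" where
  "rolls r s = Pi_pmf {1..r} 0 (\<lambda>_. die s)"

definition disadvantage :: "nat \<Rightarrow> nat \<Rightarrow> nat pmf" where
  "disadvantage r s = map_pmf (\<lambda>x. Min (x ` {1..r})) (rolls r s)"

definition mean :: "nat pmf \<Rightarrow> real" where
  "mean p = measure_pmf.expectation p real"

definition relative_loss :: "nat \<Rightarrow> nat \<Rightarrow> real" where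
  "relative_loss r s = (mean (die s) - mean (disadvantage r s)) / mean (die s)"

lemma rolls_uniform:
  assumes "s \<ge> 1"
  shows "rolls r s = pmf_of_set (PiE_dflt {1..r} 0 (\<lambda>_. {1..s}))"
  unfolding rolls_def die_def using assms by (intro Pi_pmf_of_set) auto

lemma mean_die:
  assumes "s \<ge> 1"
  shows "mean (die s) = (real s + 1) / 2"
proof -
  have "(\<Sum>k = 1..s. real k) = real s * (real s + 1) / 2"
    by (induction s) (auto simp: field_simps)
  with assms show ?thesis
    unfolding mean_def die_def by (subst integral_pmf_of_set) (auto simp: field_simps)
qed

end

theory Submission
  imports Defs "HOL-Real_Asymp.Real_Asymp"
begin

text \<open>By tail summation and independence, the mean of the minimum is
  \<open>\<Sum>j = 1..s. (j / s) ^ r\<close>, which is \<open>s / (r + 1) + O(1)\<close> by telescoping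
  \<open>j ^ (r + 1)\<close>. Dividing by \<open>(s + 1) / 2\<close> gives the ratio of means \<open>2 / (r + 1)\<close>
  in the limit.\<close>

text \<open>Since \<open>(j + 1) - j = 1\<close>, the difference of powers factors into a sum of
  \<open>Suc n\<close> products \<open>(j + 1) ^ i * j ^ (n - i)\<close>, each lying between
  \<open>j ^ n\<close> and \<open>(j + 1) ^ n\<close>.\<close>

lemma power_Suc_diff_bounds:
  fixes j :: real
  assumes "j \<ge> 0"
  shows "(real n + 1) * j ^ n \<le> (j + 1) ^ Suc n - j ^ Suc n"
    and "(j + 1) ^ Suc n - j ^ Suc n \<le> (real n + 1) * (j + 1) ^ n"
proof -
  have eq: "(j + 1) ^ Suc n - j ^ Suc n = (\<Sum>i<Suc n. (j + 1) ^ i * j ^ (n - i))"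
    using power_diff_sumr2[of "j + 1" "Suc n" j] by (simp add: mult.commute)
  have "(\<Sum>i<Suc n. j ^ n) \<le> (\<Sum>i<Suc n. (j + 1) ^ i * j ^ (n - i))"
  proof (rule sum_mono)
    fix i assume "i \<in> {..<Suc n}"
    then have "j ^ n = j ^ i * j ^ (n - i)"
      by (simp flip: power_add)
    also have "\<dots> \<le> (j + 1) ^ i * j ^ (n - i)"
      using assms by (intro mult_right_mono power_mono) auto
    finally show "j ^ n \<le> (j + 1) ^ i * j ^ (n - i)" .
  qed
  then show "(real n + 1) * j ^ n \<le> (j + 1) ^ Suc n - j ^ Suc n"
    unfolding eq by (simp add: add.commute)
  have "(\<Sum>i<Suc n. (j + 1) ^ i * j ^ (n - i)) \<le> (\<Sum>i<Suc n. (j + 1) ^ n)"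
  proof (rule sum_mono)
    fix i assume "i \<in> {..<Suc n}"
    then have "(j + 1) ^ n = (j + 1) ^ i * (j + 1) ^ (n - i)"
      by (simp flip: power_add)
    moreover have "(j + 1) ^ i * j ^ (n - i) \<le> (j + 1) ^ i * (j + 1) ^ (n - i)"
      using assms by (intro mult_left_mono power_mono) auto
    ultimately show "(j + 1) ^ i * j ^ (n - i) \<le> (j + 1) ^ n"
      by simp
  qed
  then show "(j + 1) ^ Suc n - j ^ Suc n \<le> (real n + 1) * (j + 1) ^ n"
    unfolding eq by (simp add: add.commute)
qed

text \<open>Summing the one-step bounds telescopes. Each induction step adds
  \<open>(s + 1) ^ n\<close> to the sum, which is compared with the increment of
  \<open>x ^ Suc n\<close> over \<open>[s, s + 1]\<close> for the first claim and over
  \<open>[s + 1, s + 2]\<close> for the second.\<close>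

lemma sum_powers_bounds:
  shows "real s ^ Suc n \<le> (real n + 1) * (\<Sum>j = 1..s. real j ^ n)"
    and "(real n + 1) * (\<Sum>j = 1..s. real j ^ n) \<le> (real s + 1) ^ Suc n"
proof -
  show "real s ^ Suc n \<le> (real n + 1) * (\<Sum>j = 1..s. real j ^ n)"
  proof (induction s)
    case (Suc s)
    then show ?case
      using power_Suc_diff_bounds(2)[of "real s" n] by (simp add: algebra_simps)
  qed simp
  show "(real n + 1) * (\<Sum>j = 1..s. real j ^ n) \<le> (real s + 1) ^ Suc n"
  proof (induction s)
    case (Suc s)
    then show ?case
      using power_Suc_diff_bounds(1)[of "real (Suc s)" n] by (simp add: algebra_simps)
  qed simp
qed

text \<open>Dividing both bounds by \<open>s ^ Suc n\<close> leaves a gap governed by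
  \<open>((s + 1) / s) ^ Suc n\<close>, which tends to 1 because \<open>n\<close> is fixed.\<close>

lemma sum_powers_asymptotic:
  "(\<lambda>s. (\<Sum>j = 1..s. real j ^ n) / real s ^ Suc n) \<longlonglongrightarrow> 1 / (real n + 1)"
proof (rule tendsto_sandwich)
  show "\<forall>\<^sub>F s in sequentially. 1 / (real n + 1) \<le> (\<Sum>j = 1..s. real j ^ n) / real s ^ Suc n"
    using eventually_gt_at_top[of 0]
  proof eventually_elim
    case (elim s)
    then show ?case
      using sum_powers_bounds(1)[of s n] by (simp add: divide_simps mult.commute del: power_Suc)
  qed
  show "\<forall>\<^sub>F s in sequentially. (\<Sum>j = 1..s. real j ^ n) / real s ^ Suc n
      \<le> ((real s + 1) / real s) ^ Suc n / (real n + 1)"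
    using eventually_gt_at_top[of 0]
  proof eventually_elim
    case (elim s)
    then show ?case
      using sum_powers_bounds(2)[where s = s and n = n]
      by (simp add: power_divide divide_simps mult.commute del: power_Suc)
  qed
  have "(\<lambda>s. (real s + 1) / real s) \<longlonglongrightarrow> 1"
    by real_asymp
  then have "(\<lambda>s. ((real s + 1) / real s) ^ Suc n / (real n + 1)) \<longlonglongrightarrow> 1 ^ Suc n / (real n + 1)"
    by (intro tendsto_intros) auto
  then show "(\<lambda>s. ((real s + 1) / real s) ^ Suc n / (real n + 1)) \<longlonglongrightarrow> 1 / (real n + 1)"
    by simp
qed auto

text \<open>A value \<open>x\<close> in \<open>{..s}\<close> equals the number of \<open>k\<close>
  in \<open>{1..s}\<close> with \<open>k \<le> x\<close>; expectation is then taken term by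
  term.\<close>

lemma mean_tail_sum:
  assumes "set_pmf p \<subseteq> {..s}"
  shows "mean p = (\<Sum>k = 1..s. measure_pmf.prob p {k..})"
proof -
  have fin: "finite (set_pmf p)"
    using assms finite_subset by blast
  have "mean p = measure_pmf.expectation p (\<lambda>x. \<Sum>k = 1..s. indicator {k..} x)"
    unfolding mean_def
  proof (intro integral_cong_AE AE_pmfI)
    fix x assume "x \<in> set_pmf p"
    then have "{1..s} \<inter> {k. k \<le> x} = {1..x}"
      using assms by auto
    then show "real x = (\<Sum>k = 1..s. indicator {k..} x)"
      by (simp add: indicator_def)
  qed auto
  also have "\<dots> = (\<Sum>k = 1..s. measure_pmf.expectation p (indicator {k..}))"
    by (rule Bochner_Integration.integral_sum) (auto intro: integrable_measure_pmf_finite fin)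
  finally show ?thesis
    by simp
qed

lemma prob_die_atLeast:
  assumes "1 \<le> k" "k \<le> s"
  shows "measure_pmf.prob (die s) {k..} = (real s + 1 - real k) / real s"
proof -
  have "{1..s} \<inter> {k..} = {k..s}"
    using assms by auto
  then show ?thesis
    using assms by (simp add: die_def measure_pmf_of_set of_nat_diff)
qed

text \<open>The minimum is at least \<open>k\<close> exactly when every roll is, so the event is a
  product set and independence gives a power. With \<open>r > 0\<close> the minimum is over a
  nonempty set.\<close>

lemma prob_disadvantage_atLeast:
  assumes "r > 0"
  shows "measure_pmf.prob (disadvantage r s) {k..} = measure_pmf.prob (die s) {k..} ^ r"
proof -
  have "(\<lambda>x. Min (x ` {1..r})) -` {k..} = Pi {1..r} (\<lambda>_. {k..})"
    using assms by (auto simp: Pi_def)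
  then show ?thesis
    by (simp add: disadvantage_def rolls_def measure_Pi_pmf_Pi)
qed

lemma mean_disadvantage:
  assumes "r > 0" "s > 0"
  shows "mean (disadvantage r s) = (\<Sum>j = 1..s. real j ^ r) / real s ^ r"
proof -
  have "set_pmf (die s) = {1..s}"
    using assms by (simp add: die_def)
  \<comment> \<open>The roll with index 1 witnesses that the minimum is at most
    \<open>s\<close>.\<close>
  then have "set_pmf (disadvantage r s) \<subseteq> {..s}"
    using assms
    by (auto simp: disadvantage_def rolls_def set_Pi_pmf PiE_dflt_def Min_le_iff
        intro!: bexI[of _ 1])
  then have "mean (disadvantage r s) = (\<Sum>k = 1..s. ((real s + 1 - real k) / real s) ^ r)"
    using assms
    by (simp add: mean_tail_sum prob_disadvantage_atLeast prob_die_atLeast)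
  \<comment> \<open>Reverse the order of summation: \<open>j = s + 1 - k\<close> is the number of
    faces showing at least \<open>k\<close>.\<close>
  also have "\<dots> = (\<Sum>j = 1..s. (real j / real s) ^ r)"
    by (rule sum.reindex_bij_witness[of _ "\<lambda>j. s + 1 - j" "\<lambda>j. s + 1 - j"])
      (auto simp: of_nat_diff add.commute)
  finally show ?thesis
    by (simp add: power_divide sum_divide_distrib)
qed

theorem corollary3p1p3:
  fixes r :: nat
  assumes "r > 1"
  shows "(\<lambda>s. relative_loss r s) \<longlonglongrightarrow> (real r - 1) / (real r + 1)"
proof -
  \<comment> \<open>For \<open>s > 0\<close>, \<open>?m s\<close> is the mean of the minimum divided
    by \<open>s\<close>; the factor \<open>2 * s / (s + 1)\<close> turns it into the ratio of the
    two means.\<close>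
  let ?m = "\<lambda>s. (\<Sum>j = 1..s. real j ^ r) / real s ^ Suc r"
  have "(\<lambda>s. 2 * real s / (real s + 1)) \<longlonglongrightarrow> 2"
    by real_asymp
  then have "(\<lambda>s. 1 - 2 * real s / (real s + 1) * ?m s) \<longlonglongrightarrow> 1 - 2 * (1 / (real r + 1))"
    by (intro tendsto_intros sum_powers_asymptotic)
  also have "1 - 2 * (1 / (real r + 1)) = (real r - 1) / (real r + 1)"
    by (simp add: field_simps)
  finally show ?thesis
  proof (rule Lim_transform_eventually)
    \<comment> \<open>The closed forms of both means hold for \<open>s > 0\<close>, which suffices
      for the limit.\<close>
    show "\<forall>\<^sub>F s in sequentially. 1 - 2 * real s / (real s + 1) * ?m s = relative_loss r s"
      using eventually_gt_at_top[of 0]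
    proof eventually_elim
      case (elim s)
      then show ?case
        using assms by (simp add: relative_loss_def mean_die mean_disadvantage divide_simps)
          (simp add: algebra_simps)
    qed
  qed
qed

end
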